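(* For each $m\ge2$ let $K_m$ be a random variable with $\Pr(K_m=k)=p_k(m)$ for $k=0,\dots,m-1$, let $q_k(m)=\sum_{j=k}^{m-1}p_j(m)$, let $T_m:=K_m/(m-1)\in[0,1]$, and let $\mu_m=\sum_{k=0}^{m-1}p_k(m)\,\delta_{k/(m-1)}$ be the law of $T_m$. Assume that for every $t\in[0,1]$, $q_{\lfloor t(m-1)\rfloor}(m)\to(1+2t)^{-1/2}$ as $m\to\infty$. Then for every $t\in[0,1)$, with $k_m(t)=\lceil t(m-1)\rceil$, $$\Pr(T_m\ge t)=\sum_{j=k_m(t)}^{m-1}p_j(m)=q_{k_m(t)}(m)\longrightarrow\frac{1}{\sqrt{1+2t}}\qquad(m\to\infty).$$ Assume also that $\Pr(T_m=1)=p_{m-1}(m)\to\frac{1}{\sqrt3}$ as $m\to\infty$. Then $T_m$ converges in distribution to a random variable $T$ (equivalently, $\mu_m$ converges weakly to $\mu$), where $T$ has law $$\mu(dx)=\frac{1}{(1+2x)^{3/2}}\mathbf 1_{[0,1)}(x)\,dx+\frac{1}{\sqrt3}\,\delta_1(dx).$$ Equivalently, $\Pr(T\ge t)=1/\sqrt{1+2t}$ for $0\le t<1$, and $\Pr(T=1)=1/\sqrt3$.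
   Context: For an integer $m\ge2$ let $V_m=\{v_0<v_1<\cdots<v_{m-1}\}$ ($v_0=0$, $v_{m-1}=1$) be an $m$-element chain with Gödel implication $v_p\Rightarrow_G v_q=v_{m-1}$ if $p\le q$ and $v_p\Rightarrow_G v_q=v_q$ if $p>q$. For $n\ge1$, consider the $C_{n-1}$ full bracketings of $p_1\Rightarrow_G\cdots\Rightarrow_G p_n$ in $n$ distinct variables (full binary trees with $n$ ordered leaves), $C_k$ being the Catalan numbers. Let $g_n^{(k)}$ be the number of pairs (bracketing, valuation $\{p_1,\dots,p_n\}\to V_m$) for which the bracketed formula evaluates to $v_k$, and $g_n=\sum_{k=0}^{m-1}g_n^{(k)}=m^nC_{n-1}$. Put $p_k(m):=\lim_{n\to\infty}g_n^{(k)}/g_n$ for $0\le k\le m-1$; these limits exist and $(p_k(m))_{k=0}^{m-1}$ is a probability distribution on $\{0,\dots,m-1\}$. $\delta_y$ denotes the Dirac mass at $y$. *)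

theory Defs
  imports "HOL-Probability.Probability"
begin

datatype form = Var nat | Imp form form

fun var_list :: "form \<Rightarrow> nat list" where
  "var_list (Var i) = [i]"
| "var_list (Imp a b) = var_list a @ var_list b"

text \<open>
  A full bracketing is a formula whose leaves, read from left to right, are exactly
  the variables with indices \<open>1, \<dots>, n\<close>, each occurring once.
\<close>

definition bracketings :: "nat \<Rightarrow> form set" where
  "bracketings n = {\<phi>. var_list \<phi> = [1..<Suc n]}"

text \<open>A chain \<open>v 0 < \<dots> < v (m - 1)\<close> of reals; only the indices below \<open>m\<close> matter.\<close>

definition is_chain :: "nat \<Rightarrow> (nat \<Rightarrow> real) \<Rightarrow> bool" where
  "is_chain m v \<longleftrightarrow> strict_mono_on {..<m} v \<and> v 0 = 0 \<and> v (m - 1) = 1"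

text \<open>The value \<open>1\<close> in the first branch is the top element \<open>v (m - 1)\<close> of the chain.\<close>

definition goedel_imp :: "real \<Rightarrow> real \<Rightarrow> real" where
  "goedel_imp a b = (if a \<le> b then 1 else b)"

fun eval_form :: "(nat \<Rightarrow> real) \<Rightarrow> form \<Rightarrow> real" where
  "eval_form \<sigma> (Var i) = \<sigma> i"
| "eval_form \<sigma> (Imp a b) = goedel_imp (eval_form \<sigma> a) (eval_form \<sigma> b)"

definition valuations :: "(nat \<Rightarrow> real) \<Rightarrow> nat \<Rightarrow> nat \<Rightarrow> (nat \<Rightarrow> real) set" where
  "valuations v m n = {1..n} \<rightarrow>\<^sub>E v ` {..<m}"

definition g_count :: "(nat \<Rightarrow> real) \<Rightarrow> nat \<Rightarrow> nat \<Rightarrow> nat \<Rightarrow> nat" where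
  "g_count v m n k =
     card {(\<phi>, \<sigma>). \<phi> \<in> bracketings n \<and> \<sigma> \<in> valuations v m n \<and> eval_form \<sigma> \<phi> = v k}"

definition g_total :: "(nat \<Rightarrow> real) \<Rightarrow> nat \<Rightarrow> nat \<Rightarrow> nat" where
  "g_total v m n = (\<Sum>k<m. g_count v m n k)"

text \<open>
  \<open>lim\<close> is unspecified on divergent sequences; that these sequences converge for
  every chain with \<open>m \<ge> 2\<close> is a known fact that is not proved here.
\<close>

definition p_lim :: "(nat \<Rightarrow> real) \<Rightarrow> nat \<Rightarrow> nat \<Rightarrow> real" where
  "p_lim v m k = lim (\<lambda>n. real (g_count v m n k) / real (g_total v m n))"

definition q_tail :: "(nat \<Rightarrow> real) \<Rightarrow> nat \<Rightarrow> nat \<Rightarrow> real" where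
  "q_tail v m k = (\<Sum>j=k..m-1. p_lim v m j)"

text \<open>There are only finitely many bracketings, so the cardinality above is a genuine count.\<close>

lemma var_list_nonempty: "var_list \<phi> \<noteq> []"
  by (induction \<phi>) auto

lemma finite_var_list: "finite {\<phi>. var_list \<phi> = xs}"
proof (induction xs rule: length_induct)
  case (1 xs)
  let ?I = "{0<..<length xs}"
  have "{\<phi>. var_list \<phi> = xs} \<subseteq> Var ` set xs \<union>
     (\<Union>i\<in>?I. (\<lambda>(a, b). Imp a b) ` ({\<phi>. var_list \<phi> = take i xs} \<times> {\<phi>. var_list \<phi> = drop i xs}))"
  proof
    fix \<phi> assume "\<phi> \<in> {\<phi>. var_list \<phi> = xs}"
    then have eq: "var_list \<phi> = xs" by simp
    show "\<phi> \<in> Var ` set xs \<union>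
     (\<Union>i\<in>?I. (\<lambda>(a, b). Imp a b) ` ({\<phi>. var_list \<phi> = take i xs} \<times> {\<phi>. var_list \<phi> = drop i xs}))"
    proof (cases \<phi>)
      case (Var i)
      then show ?thesis using eq by auto
    next
      case (Imp a b)
      let ?i = "length (var_list a)"
      have "?i \<in> ?I" "var_list a = take ?i xs" "var_list b = drop ?i xs"
        using eq Imp var_list_nonempty[of a] var_list_nonempty[of b] by auto
      then show ?thesis using Imp by blast
    qed
  qed
  moreover have "finite (Var ` set xs \<union>
     (\<Union>i\<in>?I. (\<lambda>(a, b). Imp a b) ` ({\<phi>. var_list \<phi> = take i xs} \<times> {\<phi>. var_list \<phi> = drop i xs})))"
  proof -
    have "finite {\<phi>. var_list \<phi> = take i xs}" "finite {\<phi>. var_list \<phi> = drop i xs}"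
      if "i \<in> ?I" for i
      using that "1" by auto
    then show ?thesis by auto
  qed
  ultimately show ?case by (rule finite_subset)
qed

lemma finite_bracketings: "finite (bracketings n)"
  unfolding bracketings_def by (rule finite_var_list)

lemma finite_valuations: "finite (valuations v m n)"
  unfolding valuations_def by (intro finite_PiE) auto

definition mu_fin :: "(nat \<Rightarrow> real) \<Rightarrow> nat \<Rightarrow> real measure" where
  "mu_fin v m = measure_of UNIV (sets borel)
     (\<lambda>A. \<Sum>k<m. ennreal (p_lim v m k) * emeasure (return borel (real k / (real m - 1))) A)"

text \<open>The measure \<open>(1 + 2x)^{-3/2} 1_{[0,1)}(x) dx + 3^{-1/2} \<delta>_1(dx)\<close>.\<close>

definition mu_limit :: "real measure" where
  "mu_limit = measure_of UNIV (sets borel)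
     (\<lambda>A. emeasure (density lborel
              (\<lambda>x. ennreal (1 / (1 + 2 * x) powr (3 / 2) * indicator {0..<1} x))) A
          + ennreal (1 / sqrt 3) * emeasure (return borel 1) A)"

text \<open>Both set functions are countably additive, so \<open>measure_of\<close> takes these values.\<close>

lemma emeasure_mu_fin:
  assumes "A \<in> sets borel"
  shows "emeasure (mu_fin v m) A =
    (\<Sum>k<m. ennreal (p_lim v m k) * emeasure (return borel (real k / (real m - 1))) A)"
proof (rule emeasure_measure_of[OF mu_fin_def])
  show "countably_additive (sets (mu_fin v m))
    (\<lambda>A. \<Sum>k<m. ennreal (p_lim v m k) * emeasure (return borel (real k / (real m - 1))) A)"
  proof (rule countably_additiveI)
    fix A :: "nat \<Rightarrow> real set"
    assume A: "range A \<subseteq> sets (mu_fin v m)" "disjoint_family A" "\<Union> (range A) \<in> sets (mu_fin v m)"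
    have "sets (mu_fin v m) = sets borel"
      unfolding mu_fin_def using sets.sigma_sets_eq[of "borel :: real measure"] by (simp add: sets_measure_of)
    then have "(\<Sum>i. emeasure (return borel c) (A i)) = emeasure (return borel c) (\<Union> (range A))"
      for c :: real
      using A by (intro suminf_emeasure) auto
    then show "(\<Sum>i. \<Sum>k<m. ennreal (p_lim v m k)
          * emeasure (return borel (real k / (real m - 1))) (A i))
      = (\<Sum>k<m. ennreal (p_lim v m k)
          * emeasure (return borel (real k / (real m - 1))) (\<Union> (range A)))"
      by (subst suminf_sum) (auto simp: ennreal_suminf_cmult)
  qed
qed (use assms sets.sigma_sets_eq[of "borel :: real measure"] in
      \<open>auto simp: mu_fin_def positive_def\<close>)

lemma emeasure_mu_limit:
  assumes "A \<in> sets borel"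
  shows "emeasure mu_limit A =
    emeasure (density lborel
              (\<lambda>x. ennreal (1 / (1 + 2 * x) powr (3 / 2) * indicator {0..<1} x))) A
          + ennreal (1 / sqrt 3) * emeasure (return borel 1) A" (is "_ = emeasure ?D A + _")
proof (rule emeasure_measure_of[OF mu_limit_def])
  show "countably_additive (sets mu_limit)
    (\<lambda>A. emeasure ?D A + ennreal (1 / sqrt 3) * emeasure (return borel 1) A)"
  proof (rule countably_additiveI)
    fix A :: "nat \<Rightarrow> real set"
    assume A: "range A \<subseteq> sets mu_limit" "disjoint_family A" "\<Union> (range A) \<in> sets mu_limit"
    have s: "sets mu_limit = sets borel"
      unfolding mu_limit_def using sets.sigma_sets_eq[of "borel :: real measure"] by (simp add: sets_measure_of)
    have 1: "(\<Sum>i. emeasure (return borel 1) (A i)) = emeasure (return borel (1::real)) (\<Union> (range A))"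
      using A s by (intro suminf_emeasure) auto
    have 2: "(\<Sum>i. emeasure ?D (A i)) = emeasure ?D (\<Union> (range A))"
      using A s by (intro suminf_emeasure) auto
    show "(\<Sum>i. emeasure ?D (A i) + ennreal (1 / sqrt 3) * emeasure (return borel 1) (A i))
      = emeasure ?D (\<Union> (range A)) + ennreal (1 / sqrt 3) * emeasure (return borel 1) (\<Union> (range A))"
      by (subst suminf_add[symmetric]) (auto simp only: ennreal_suminf_cmult 1 2 summableI)
  qed
qed (use assms sets.sigma_sets_eq[of "borel :: real measure"] in
      \<open>auto simp: mu_limit_def positive_def\<close>)

text \<open>
  \<open>weak_conv_m\<close> is convergence of the distribution functions at every continuity
  point of the limit.
\<close>

definition conv_in_distribution ::
    "(nat \<Rightarrow> 'a measure) \<Rightarrow> (nat \<Rightarrow> 'a \<Rightarrow> real) \<Rightarrow> 'b measure \<Rightarrow> ('b \<Rightarrow> real) \<Rightarrow> bool" where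
  "conv_in_distribution M X N Y \<longleftrightarrow>
     weak_conv_m (\<lambda>m. distr (M m) borel (X m)) (distr N borel Y)"

definition conv_weakly :: "(nat \<Rightarrow> real measure) \<Rightarrow> real measure \<Rightarrow> bool" where
  "conv_weakly Ms L \<longleftrightarrow>
     (\<forall>f :: real \<Rightarrow> real. continuous_on UNIV f \<and> bounded (range f) \<longrightarrow>
        (\<lambda>m. integral\<^sup>L (Ms m) f) \<longlonglongrightarrow> integral\<^sup>L L f)"

end

theory Submission
  imports Defs "HOL-Real_Asymp.Real_Asymp"
begin

text \<open>
  Since the tails of \<open>p\<close> are antitone in the index and
  \<open>\<lfloor>t (m - 1)\<rfloor> \<le> \<lceil>t (m - 1)\<rceil> \<le> \<lfloor>s (m - 1)\<rfloor>\<close> for \<open>s > t\<close> and large \<open>m\<close>, the assumed limits at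
  \<open>\<lfloor>\<cdot>\<rfloor>\<close> squeeze both \<open>Pr(T\<^sub>m \<ge> t)\<close> and \<open>Pr(T\<^sub>m > t)\<close> to \<open>1 / sqrt (1 + 2t)\<close>, by continuity of that
  function. Hence the distribution functions converge at every point, and the limit is the
  distribution function of \<open>mu_limit\<close>, which is determined by the same squeeze.
\<close>

section \<open>One-sided squeezing of limits\<close>

text \<open>The upper bound is taken at \<open>x\<close> itself, the lower bounds only at points
  \<open>s > x\<close>; letting \<open>s\<close> decrease to \<open>x\<close>, right-continuity of
  \<open>h\<close> closes the gap. It is applied to closed tails bounded by floor-indexed sums, to
  open tails bounded by closed ones, and to a constant sequence.\<close>

lemma tendsto_squeeze_at_right:
  fixes a :: "'i \<Rightarrow> real" and h :: "real \<Rightarrow> real"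
  assumes "x < b"
    and h: "(h \<longlongrightarrow> h x) (at_right x)"
    and upper: "\<forall>\<^sub>F m in F. a m \<le> q x m" "(q x \<longlongrightarrow> h x) F"
    and lower: "\<And>s. x < s \<Longrightarrow> s < b \<Longrightarrow> \<forall>\<^sub>F m in F. q s m \<le> a m"
      "\<And>s. x < s \<Longrightarrow> s < b \<Longrightarrow> (q s \<longlongrightarrow> h s) F"
  shows "(a \<longlongrightarrow> h x) F"
proof (rule order_tendstoI)
  fix y assume "y < h x"
  have "\<forall>\<^sub>F s in at_right x. y < h s \<and> s \<in> {x<..<b}"
    using order_tendstoD(1)[OF h \<open>y < h x\<close>] eventually_at_right_real[OF \<open>x < b\<close>]
    by eventually_elim auto
  then obtain s where s: "y < h s" "x < s" "s < b"
    using eventually_happens'[of "at_right x"] by auto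
  show "\<forall>\<^sub>F m in F. y < a m"
    using order_tendstoD(1)[OF lower(2)[OF s(2,3)] s(1)] lower(1)[OF s(2,3)]
    by eventually_elim auto
next
  fix y assume "h x < y"
  show "\<forall>\<^sub>F m in F. a m < y"
    using order_tendstoD(2)[OF upper(2) \<open>h x < y\<close>] upper(1) by eventually_elim auto
qed

lemma tendsto_inverse_sqrt_at_right:
  fixes x :: real
  assumes "0 \<le> x"
  shows "((\<lambda>t. 1 / sqrt (1 + 2 * t)) \<longlongrightarrow> 1 / sqrt (1 + 2 * x)) (at_right x)"
  using assms by (intro tendsto_intros) auto

section \<open>Distribution functions recovered from tails\<close>

lemma (in real_distribution) cdf_eq_1_minus: "cdf M x = 1 - prob {x<..}"
proof -
  have "UNIV - {..x} = {x<..}" by auto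
  then show ?thesis using prob_compl[of "{..x}"] by (simp add: cdf_def)
qed

text \<open>The tail at \<open>t = 0\<close> has mass 1, so nothing lies below 0. As
  \<open>t\<close> increases to 1, the tails bound the mass of \<open>{1..}\<close> by
  \<open>1 / sqrt 3\<close>, which the atom already exhausts, so nothing lies above 1. In between,
  open tails are squeezed by closed ones.\<close>

lemma cdf_of_tails:
  assumes "real_distribution D"
    and tail: "\<And>t. t \<in> {0..<1} \<Longrightarrow> measure D {t..} = 1 / sqrt (1 + 2 * t)"
    and atom: "measure D {1} = 1 / sqrt 3"
  shows "cdf D x = (if x < 0 then 0 else if x < 1 then 1 - 1 / sqrt (1 + 2 * x) else 1)"
proof -
  interpret real_distribution D by fact
  consider "x < 0" | "0 \<le> x" "x < 1" | "1 \<le> x" by linarith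
  then show ?thesis
  proof cases
    case 1
    have "1 = prob {0..}" using tail[of 0] by simp
    also have "\<dots> \<le> prob {x<..}" using 1 by (intro finite_measure_mono) auto
    finally show ?thesis using 1 prob_le_1[of "{x<..}"] by (simp add: cdf_eq_1_minus)
  next
    case 2
    \<comment> \<open>A constant sequence turns the squeeze into an identity between two numbers, by
      uniqueness of limits.\<close>
    have "((\<lambda>_. prob {x<..}) \<longlongrightarrow> 1 / sqrt (1 + 2 * x)) sequentially"
    proof (rule tendsto_squeeze_at_right[where q = "\<lambda>s _. prob {s..}", OF 2(2)
          tendsto_inverse_sqrt_at_right[OF 2(1)]])
      show "\<forall>\<^sub>F _ in sequentially. prob {x<..} \<le> prob {x..}"
        by (intro always_eventually allI finite_measure_mono) auto
      show "\<forall>\<^sub>F _ in sequentially. prob {s..} \<le> prob {x<..}" if "x < s" for s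
        using that by (intro always_eventually allI finite_measure_mono) auto
    qed (use 2 tail in auto)
    then have "prob {x<..} = 1 / sqrt (1 + 2 * x)" by (simp add: tendsto_const_iff)
    then show ?thesis using 2 by (simp add: cdf_eq_1_minus)
  next
    case 3
    have lim: "((\<lambda>t. 1 / sqrt (1 + 2 * t)) \<longlongrightarrow> 1 / sqrt (1 + 2 * 1)) (at_left (1::real))"
      by (intro tendsto_intros) auto
    have "\<forall>\<^sub>F t in at_left (1::real). prob {1..} \<le> 1 / sqrt (1 + 2 * t)"
      using eventually_at_left_real[of 0 "1::real", OF zero_less_one]
    proof eventually_elim
      case (elim t)
      then have "prob {1..} \<le> prob {t..}" by (intro finite_measure_mono) auto
      then show ?case using tail[of t] elim by simp
    qed
    from tendsto_lowerbound[OF lim this] have "prob {1..} \<le> 1 / sqrt 3" by simp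
    moreover have "{1..} = {1} \<union> {1::real<..}" by auto
    then have "prob {1..} = prob {1} + prob {1<..}"
      by (metis finite_measure_Union disjoint_iff greaterThan_iff less_irrefl singletonD
          events_eq_borel borel_open open_greaterThan borel_singleton sets.empty_sets sets.insert_in_sets space_borel)
    ultimately have "prob {1<..} = 0" using atom measure_nonneg[of D "{1<..}"] by simp
    moreover have "prob {x<..} \<le> prob {1<..}" using 3 by (intro finite_measure_mono) auto
    ultimately show ?thesis using 3 measure_nonneg[of D "{x<..}"] by (simp add: cdf_eq_1_minus)
  qed
qed

section \<open>The limit law: tails, total mass, characterisation\<close>

text \<open>An antiderivative of the density is \<open>- ((1 + 2 * x) powr (-1/2))\<close>, whose
  value at 1 is \<open>- 1 / sqrt 3\<close>.\<close>

lemma nn_integral_limit_density: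
  assumes "0 \<le> t" "t < 1"
  shows "(\<integral>\<^sup>+ x. ennreal (1 / (1 + 2 * x) powr (3 / 2) * indicator {0..<1} x) * indicator {t..} x \<partial>lborel)
    = ennreal (1 / sqrt (1 + 2 * t) - 1 / sqrt 3)"
proof -
  have "(\<integral>\<^sup>+ x. ennreal (1 / (1 + 2 * x) powr (3 / 2) * indicator {0..<1} x) * indicator {t..} x \<partial>lborel)
     = (\<integral>\<^sup>+ x. ennreal (1 / (1 + 2 * x) powr (3 / 2)) * indicator {t..1} x \<partial>lborel)"
    \<comment> \<open>Closing the interval at 1 adds only a null set and makes the fundamental
      theorem on compact intervals applicable.\<close>
    by (rule nn_integral_cong_AE, rule eventually_mono[OF AE_lborel_singleton[of 1]])
      (use assms in \<open>auto split: split_indicator\<close>)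
  also have "\<dots> = ennreal (- ((1 + 2 * 1) powr (-1/2)) - - ((1 + 2 * t) powr (-1/2)))"
  proof (rule nn_integral_FTC_Icc)
    fix x :: real assume "x \<in> {t..1}"
    then have "0 < 1 + 2 * x" using assms by auto
    moreover from this have "(1 + 2 * x) powr (- (3 / 2)) = 1 / (1 + 2 * x) powr (3 / 2)"
      by (simp add: powr_minus_divide)
    ultimately show "((\<lambda>x. - ((1 + 2 * x) powr (-1/2))) has_real_derivative
        1 / (1 + 2 * x) powr (3 / 2)) (at x)"
      by (auto intro!: derivative_eq_intros)
  qed (use assms in auto)
  also have "\<dots> = ennreal (1 / sqrt (1 + 2 * t) - 1 / sqrt 3)"
    using assms by (simp add: powr_minus_divide powr_half_sqrt)
  finally show ?thesis .
qed

lemma sets_mu_limit: "sets mu_limit = sets borel"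
  using sets.sigma_sets_eq[of "borel :: real measure"]
  by (simp add: mu_limit_def sets_measure_of)

lemma sets_mu_fin: "sets (mu_fin v m) = sets borel"
  using sets.sigma_sets_eq[of "borel :: real measure"]
  by (simp add: mu_fin_def sets_measure_of)

text \<open>The \<open>1 / sqrt 3\<close> subtracted in the integral of the density is exactly the
  atom at 1, which lies in every tail with \<open>t < 1\<close>.\<close>

lemma emeasure_mu_limit_tail:
  assumes "0 \<le> t" "t < 1"
  shows "emeasure mu_limit {t..} = ennreal (1 / sqrt (1 + 2 * t))"
proof -
  \<comment> \<open>The density part is thus a nonnegative real, so the two \<open>ennreal\<close>
    summands may be added as reals.\<close>
  have "1 / sqrt 3 \<le> 1 / sqrt (1 + 2 * t)" using assms by (intro divide_left_mono) auto
  then show ?thesis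
    using assms nn_integral_limit_density[OF assms]
    by (simp add: emeasure_mu_limit emeasure_density flip: ennreal_plus)
qed

text \<open>The tail at 0 already has mass 1, and the negative half-line is null for the density and
  for the atom.\<close>

lemma real_distribution_mu_limit: "real_distribution mu_limit"
proof -
  have space: "space mu_limit = UNIV" using sets_eq_imp_space_eq[OF sets_mu_limit] by simp
  have dens: "emeasure (density lborel
      (\<lambda>x. ennreal (1 / (1 + 2 * x) powr (3 / 2) * indicator {0..<1} x))) {..<0} = 0"
    by (subst emeasure_density) (auto simp: nn_integral_0_iff_AE split: split_indicator)
  have "emeasure mu_limit {..<0} = 0"
    using dens by (simp add: emeasure_mu_limit)
  moreover have "emeasure mu_limit {0..} = 1" using emeasure_mu_limit_tail[of 0] by simp
  moreover have "emeasure mu_limit ({..<0} \<union> {0..}) = emeasure mu_limit {..<0} + emeasure mu_limit {0..}"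
    by (intro plus_emeasure[symmetric]) (auto simp: sets_mu_limit)
  moreover have "{..<0} \<union> {0::real..} = UNIV" by auto
  ultimately have "emeasure mu_limit UNIV = 1" by simp
  then have "prob_space mu_limit" by (intro prob_spaceI) (simp add: space)
  then show ?thesis
    by (simp add: real_distribution_def real_distribution_axioms_def sets_mu_limit)
qed

lemma measure_mu_limit_tail:
  assumes "t \<in> {0..<1}"
  shows "measure mu_limit {t..} = 1 / sqrt (1 + 2 * t)"
  using assms by (simp add: measure_def emeasure_mu_limit_tail)

lemma measure_mu_limit_atom: "measure mu_limit {1} = 1 / sqrt 3"
proof -
  have "emeasure (density lborel
      (\<lambda>x. ennreal (1 / (1 + 2 * x) powr (3 / 2) * indicator {0..<1} x))) {1} = 0"
    by (subst emeasure_density) (auto simp: nn_integral_0_iff_AE split: split_indicator)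
  then show ?thesis by (simp add: measure_def emeasure_mu_limit)
qed

lemma cdf_mu_limit:
  "cdf mu_limit x = (if x < 0 then 0 else if x < 1 then 1 - 1 / sqrt (1 + 2 * x) else 1)"
  by (rule cdf_of_tails[OF real_distribution_mu_limit])
    (simp_all add: measure_mu_limit_tail measure_mu_limit_atom)

text \<open>A real distribution is determined by its distribution function, and
  \<open>cdf_of_tails\<close> computes the same function for \<open>D\<close> and for
  \<open>mu_limit\<close>.\<close>

lemma eq_mu_limit_iff:
  assumes "real_distribution D"
  shows "D = mu_limit \<longleftrightarrow>
    (\<forall>t\<in>{0..<1}. measure D {t..} = 1 / sqrt (1 + 2 * t)) \<and> measure D {1} = 1 / sqrt 3"
proof
  assume "(\<forall>t\<in>{0..<1}. measure D {t..} = 1 / sqrt (1 + 2 * t)) \<and> measure D {1} = 1 / sqrt 3"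
  then have "cdf D x = cdf mu_limit x" for x
    using cdf_of_tails[OF assms] by (simp add: cdf_mu_limit)
  then show "D = mu_limit" by (intro cdf_unique assms real_distribution_mu_limit ext)
qed (simp add: measure_mu_limit_tail measure_mu_limit_atom)

section \<open>Laws of variables with finitely many natural values\<close>

lemma measurable_nat_valued:
  assumes "K \<in> measurable M (count_space {..<m::nat})"
  shows "(\<lambda>\<omega>. f (K \<omega>)) \<in> borel_measurable M"
  by (rule measurable_compose[OF assms]) simp

lemma sets_nat_valued:
  assumes "K \<in> measurable M (count_space {..<m::nat})"
  shows "{\<omega> \<in> space M. P (K \<omega>)} \<in> sets M"
  by (rule predE, rule measurable_compose[OF assms]) simp

text \<open>The predicate is left general for two uses: membership of the rescaled value in a Borel
  set, and a lower bound on the value.\<close>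

lemma (in prob_space) prob_nat_valued:
  assumes K: "K \<in> measurable M (count_space {..<m::nat})"
  shows "prob {\<omega> \<in> space M. P (K \<omega>)} = (\<Sum>k | k < m \<and> P k. prob {\<omega> \<in> space M. K \<omega> = k})"
proof -
  have lt: "\<omega> \<in> space M \<Longrightarrow> K \<omega> < m" for \<omega> using measurable_space[OF K] by auto
  have "prob (\<Union>k\<in>{k. k < m \<and> P k}. {\<omega> \<in> space M. K \<omega> = k})
      = (\<Sum>k | k < m \<and> P k. prob {\<omega> \<in> space M. K \<omega> = k})"
    by (intro finite_measure_finite_Union) (auto simp: disjoint_family_on_def intro: sets_nat_valued[OF K])
  moreover have "(\<Union>k\<in>{k. k < m \<and> P k}. {\<omega> \<in> space M. K \<omega> = k}) = {\<omega> \<in> space M. P (K \<omega>)}"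
    using lt by auto
  ultimately show ?thesis by simp
qed

text \<open>A Borel set selects the indices whose rescaled value it contains; the Dirac masses in
  \<open>mu_fin\<close> make the same selection.\<close>

lemma (in prob_space) distr_eq_mu_fin:
  assumes K: "K \<in> measurable M (count_space {..<m})"
    and law: "\<And>k. k < m \<Longrightarrow> prob {\<omega> \<in> space M. K \<omega> = k} = p_lim v m k"
  shows "distr M borel (\<lambda>\<omega>. real (K \<omega>) / (real m - 1)) = mu_fin v m"
proof (rule measure_eqI)
  fix A :: "real set" assume "A \<in> sets (distr M borel (\<lambda>\<omega>. real (K \<omega>) / (real m - 1)))"
  then have A: "A \<in> sets borel" by simp
  \<comment> \<open>\<open>p_lim\<close> is a bare \<open>lim\<close>, and \<open>ennreal\<close>
    sends negative reals to 0. Nonnegativity is read off from \<open>law\<close>, which makes these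
    numbers probabilities.\<close>
  have nonneg: "0 \<le> p_lim v m k" if "k < m" for k
    using law[OF that] measure_nonneg[of M] by metis
  have "emeasure (distr M borel (\<lambda>\<omega>. real (K \<omega>) / (real m - 1))) A
      = emeasure M ((\<lambda>\<omega>. real (K \<omega>) / (real m - 1)) -` A \<inter> space M)"
    by (rule emeasure_distr[OF measurable_nat_valued[OF K] A])
  also have "(\<lambda>\<omega>. real (K \<omega>) / (real m - 1)) -` A \<inter> space M
      = {\<omega> \<in> space M. real (K \<omega>) / (real m - 1) \<in> A}" by auto
  also have "emeasure M \<dots> = ennreal (\<Sum>k | k < m \<and> real k / (real m - 1) \<in> A. p_lim v m k)"
    using prob_nat_valued[OF K, of "\<lambda>k. real k / (real m - 1) \<in> A"] law
    by (simp add: emeasure_eq_measure)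
  also have "\<dots> = (\<Sum>k | k < m \<and> real k / (real m - 1) \<in> A. ennreal (p_lim v m k))"
    using nonneg by (intro sum_ennreal[symmetric]) auto
  also have "\<dots> = (\<Sum>k<m. ennreal (p_lim v m k) * emeasure (return borel (real k / (real m - 1))) A)"
    using A by (intro sum.mono_neutral_cong_left) (auto split: split_indicator)
  also have "\<dots> = emeasure (mu_fin v m) A" by (rule emeasure_mu_fin[OF A, symmetric])
  finally show "emeasure (distr M borel (\<lambda>\<omega>. real (K \<omega>) / (real m - 1))) A = emeasure (mu_fin v m) A" .
qed (simp add: sets_mu_fin)

lemma (in prob_space) prob_ge_eq_q_tail:
  assumes K: "K \<in> measurable M (count_space {..<m})" and "m \<ge> 2"
    and law: "\<And>k. k < m \<Longrightarrow> prob {\<omega> \<in> space M. K \<omega> = k} = p_lim v m k"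
  shows "prob {\<omega> \<in> space M. K \<omega> \<ge> k} = q_tail v m k"
proof -
  \<comment> \<open>Subtraction is truncated: \<open>m - 1\<close> is the last index below
    \<open>m\<close> only for positive \<open>m\<close>.\<close>
  have "{j. j < m \<and> k \<le> j} = {k..m - 1}" using \<open>m \<ge> 2\<close> by auto
  then have "prob {\<omega> \<in> space M. K \<omega> \<ge> k} = (\<Sum>j = k..m - 1. prob {\<omega> \<in> space M. K \<omega> = j})"
    using prob_nat_valued[OF K, of "\<lambda>j. k \<le> j"] by simp
  also have "\<dots> = q_tail v m k"
    unfolding q_tail_def using \<open>m \<ge> 2\<close> law by (intro sum.cong) auto
  finally show ?thesis .
qed

section \<open>Convergence in distribution and weak convergence\<close>

text \<open>Open tails are the complements that \<open>cdf\<close> sees. Since all mass lies in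
  \<open>{0..1}\<close>, the distribution functions are 0 left of 0 and 1 from 1 on for every
  \<open>m \<ge> 2\<close>, so convergence holds even at 1, where the limit jumps.\<close>

lemma weak_conv_m_mu_limit:
  assumes prob: "\<And>m. m \<ge> 2 \<Longrightarrow> real_distribution (D m)"
    and supp: "\<And>m. m \<ge> 2 \<Longrightarrow> measure (D m) {0..1} = 1"
    and tail: "\<And>t. t \<in> {0..<1} \<Longrightarrow> (\<lambda>m. measure (D m) {t<..}) \<longlonglongrightarrow> 1 / sqrt (1 + 2 * t)"
  shows "weak_conv_m D mu_limit"
  unfolding weak_conv_m_def weak_conv_def
proof (intro allI impI)
  fix x :: real
  have ge2: "\<forall>\<^sub>F m in sequentially. m \<ge> (2::nat)" by (rule eventually_ge_at_top)
  consider "x < 0" | "x \<in> {0..<1}" | "1 \<le> x" by fastforce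
  then show "(\<lambda>m. cdf (D m) x) \<longlonglongrightarrow> cdf mu_limit x"
  proof cases
    case 1
    have "\<forall>\<^sub>F m in sequentially. cdf (D m) x = 0"
      using ge2
    proof eventually_elim
      case (elim m)
      interpret real_distribution "D m" using prob elim by blast
      have "prob {0..1} \<le> prob {x<..}" using 1 by (intro finite_measure_mono) auto
      then show ?case using supp[OF elim] prob_le_1[of "{x<..}"] by (simp add: cdf_eq_1_minus)
    qed
    then show ?thesis unfolding cdf_mu_limit using 1 by (auto intro: tendsto_eventually)
  next
    case 2
    have "\<forall>\<^sub>F m in sequentially. 1 - measure (D m) {x<..} = cdf (D m) x"
      using ge2
      by eventually_elim (simp add: prob real_distribution.cdf_eq_1_minus)
    moreover have "(\<lambda>m. 1 - measure (D m) {x<..}) \<longlonglongrightarrow> 1 - 1 / sqrt (1 + 2 * x)"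
      by (intro tendsto_diff tendsto_const tail 2)
    ultimately show ?thesis unfolding cdf_mu_limit using 2 by (auto dest: Lim_transform_eventually)
  next
    case 3
    have "\<forall>\<^sub>F m in sequentially. cdf (D m) x = 1"
      using ge2
    proof eventually_elim
      case (elim m)
      interpret real_distribution "D m" using prob elim by blast
      have "prob {0..1} \<le> prob {..x}" using 3 by (intro finite_measure_mono) auto
      then show ?case using supp[OF elim] prob_le_1[of "{..x}"] by (simp add: cdf_def)
    qed
    then show ?thesis unfolding cdf_mu_limit using 3 by (auto intro: tendsto_eventually)
  qed
qed

text \<open>The integral criterion for weak convergence wants every member of the sequence to be a
  distribution. Here this is known only from \<open>n\<close> on, so the sequence is shifted by
  \<open>n\<close> and the limit is shifted back.\<close>

lemma conv_weakly_of_weak_conv_m: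
  assumes "weak_conv_m D L" "real_distribution L"
    and D: "\<And>m. m \<ge> n \<Longrightarrow> real_distribution (D m)"
  shows "conv_weakly D L"
  unfolding conv_weakly_def
proof (intro allI impI)
  fix f :: "real \<Rightarrow> real"
  assume f: "continuous_on UNIV f \<and> bounded (range f)"
  then obtain B where "norm (f x) \<le> B" for x by (auto simp: bounded_iff)
  moreover have "weak_conv_m (\<lambda>m. D (m + n)) L"
    using assms(1) unfolding weak_conv_m_def weak_conv_def
    by (auto intro: LIMSEQ_ignore_initial_segment)
  ultimately have "(\<lambda>m. integral\<^sup>L (D (m + n)) f) \<longlonglongrightarrow> integral\<^sup>L L f"
    using f assms(2) D
    by (intro weak_conv_imp_integral_bdd_continuous_conv) (auto simp: continuous_on_eq_continuous_at)
  then show "(\<lambda>m. integral\<^sup>L (D m) f) \<longlonglongrightarrow> integral\<^sup>L L f" by (rule LIMSEQ_offset)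
qed

section \<open>Rounding of indices and the limit theorem\<close>

text \<open>The two roundings move the numbers by less than 2 in total, while the gap
  \<open>(s - t) * (real m - 1)\<close> tends to infinity.\<close>

lemma eventually_ceiling_le_floor:
  fixes s t :: real
  assumes "t < s"
  shows "\<forall>\<^sub>F m in sequentially. \<lceil>t * (real m - 1)\<rceil> \<le> \<lfloor>s * (real m - 1)\<rfloor>"
proof -
  have "filterlim (\<lambda>m. (s - t) * (real m - 1)) at_top sequentially"
    using assms by real_asymp
  then have "\<forall>\<^sub>F m in sequentially. 2 \<le> (s - t) * (real m - 1)"
    by (auto simp: filterlim_at_top)
  then show ?thesis by eventually_elim (simp add: algebra_simps; linarith)
qed

theorem theorem7:
  fixes v :: "nat \<Rightarrow> nat \<Rightarrow> real"
    and M :: "nat \<Rightarrow> 'a measure"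
    and K :: "nat \<Rightarrow> 'a \<Rightarrow> nat"
    and T :: "nat \<Rightarrow> 'a \<Rightarrow> real"
  assumes chain: "\<And>m. m \<ge> 2 \<Longrightarrow> is_chain m (v m)"
    and prob: "\<And>m. m \<ge> 2 \<Longrightarrow> prob_space (M m)"
    and K_rv: "\<And>m. m \<ge> 2 \<Longrightarrow> K m \<in> measurable (M m) (count_space {..<m})"
    and K_law: "\<And>m k. m \<ge> 2 \<Longrightarrow> k < m \<Longrightarrow>
      measure (M m) {\<omega> \<in> space (M m). K m \<omega> = k} = p_lim (v m) m k"
    and T_eq: "\<And>m \<omega>. T m \<omega> = real (K m \<omega>) / (real m - 1)"
    and q_conv: "\<And>t. t \<in> {0..1} \<Longrightarrow>
      (\<lambda>m. q_tail (v m) m (nat \<lfloor>t * (real m - 1)\<rfloor>)) \<longlonglongrightarrow> (1 + 2 * t) powr (- 1 / 2)"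
  shows
    "(\<forall>m\<ge>2. distr (M m) borel (T m) = mu_fin (v m) m)
     \<and> (\<forall>t\<in>{0..<1}.
          (\<forall>m\<ge>2.
             measure (M m) {\<omega> \<in> space (M m). T m \<omega> \<ge> t}
               = (\<Sum>j = nat \<lceil>t * (real m - 1)\<rceil>..m - 1. p_lim (v m) m j)
           \<and> (\<Sum>j = nat \<lceil>t * (real m - 1)\<rceil>..m - 1. p_lim (v m) m j)
               = q_tail (v m) m (nat \<lceil>t * (real m - 1)\<rceil>))
        \<and> (\<lambda>m. measure (M m) {\<omega> \<in> space (M m). T m \<omega> \<ge> t}) \<longlonglongrightarrow> 1 / sqrt (1 + 2 * t))
     \<and> (\<forall>m\<ge>2. measure (M m) {\<omega> \<in> space (M m). T m \<omega> = 1} = p_lim (v m) m (m - 1))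
     \<and> ((\<lambda>m. measure (M m) {\<omega> \<in> space (M m). T m \<omega> = 1}) \<longlonglongrightarrow> 1 / sqrt 3 \<longrightarrow>
          (\<exists>(N :: real measure) X. prob_space N \<and> X \<in> borel_measurable N
             \<and> distr N borel X = mu_limit \<and> conv_in_distribution M T N X)
        \<and> conv_weakly (\<lambda>m. mu_fin (v m) m) mu_limit
        \<and> (\<forall>(N :: 'b measure) X. prob_space N \<and> X \<in> borel_measurable N \<longrightarrow>
             (distr N borel X = mu_limit \<longrightarrow> conv_in_distribution M T N X)
           \<and> (distr N borel X = mu_limit \<longleftrightarrow>
                (\<forall>t\<in>{0..<1}. measure N {\<omega> \<in> space N. X \<omega> \<ge> t} = 1 / sqrt (1 + 2 * t))
                \<and> measure N {\<omega> \<in> space N. X \<omega> = 1} = 1 / sqrt 3)))"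
proof -
  let ?h = "\<lambda>t::real. 1 / sqrt (1 + 2 * t)"
  let ?q = "\<lambda>t m. q_tail (v m) m (nat \<lfloor>t * (real m - 1)\<rfloor>)"
  have T: "T m = (\<lambda>\<omega>. real (K m \<omega>) / (real m - 1))" for m using T_eq by auto
  have T_rv: "T m \<in> borel_measurable (M m)" if "m \<ge> 2" for m
    unfolding T by (rule measurable_nat_valued[OF K_rv[OF that]])
  have distr_T: "distr (M m) borel (T m) = mu_fin (v m) m" if "m \<ge> 2" for m
    unfolding T by (rule prob_space.distr_eq_mu_fin[OF prob K_rv K_law]) (use that in auto)
  have K_ge: "measure (M m) {\<omega> \<in> space (M m). K m \<omega> \<ge> k} = q_tail (v m) m k" if "m \<ge> 2" for m k
    by (rule prob_space.prob_ge_eq_q_tail[OF prob K_rv _ K_law]) (use that in auto)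
  \<comment> \<open>An integer is at least a real number iff it is at least its ceiling;
    \<open>nat\<close> replaces a negative ceiling by 0, a bound every natural number meets.\<close>
  have T_ge_iff: "T m \<omega> \<ge> t \<longleftrightarrow> K m \<omega> \<ge> nat \<lceil>t * (real m - 1)\<rceil>" if "m \<ge> 2" for m \<omega> t
    using that by (simp add: T pos_le_divide_eq ceiling_le_iff nat_le_iff)
  have T_ge: "measure (M m) {\<omega> \<in> space (M m). T m \<omega> \<ge> t}
      = q_tail (v m) m (nat \<lceil>t * (real m - 1)\<rceil>)" if "m \<ge> 2" for m t
    unfolding T_ge_iff[OF that] by (rule K_ge[OF that])
  have T_one: "measure (M m) {\<omega> \<in> space (M m). T m \<omega> = 1} = p_lim (v m) m (m - 1)"
    if "m \<ge> 2" for m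
  proof -
    have "T m \<omega> = 1 \<longleftrightarrow> K m \<omega> = m - 1" for \<omega> using that by (auto simp: T field_simps)
    then show ?thesis using K_law[of m "m - 1"] that by simp
  qed
  have q_lim: "?q t \<longlonglongrightarrow> ?h t" if "t \<in> {0..1}" for t
    using q_conv[OF that] that by (simp add: powr_minus_divide powr_half_sqrt)
  \<comment> \<open>Through \<open>K_ge\<close> the tails are probabilities of nested events, hence
    antitone.\<close>
  have q_anti: "q_tail (v m) m k \<le> q_tail (v m) m j" if "m \<ge> 2" "j \<le> k" for m j k
  proof -
    interpret prob_space "M m" using prob that by blast
    show ?thesis unfolding K_ge[OF that(1), symmetric] using that
      by (intro finite_measure_mono sets_nat_valued[OF K_rv]) auto
  qed
  have T_set: "{\<omega> \<in> space (M m). T m \<omega> \<in> A} \<in> sets (M m)" if "m \<ge> 2" "A \<in> sets borel" for m A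
    using measurable_sets[OF T_rv that(2)] that(1) by (simp add: vimage_def Int_def conj_commute)
  have T_gt_le_T_ge: "measure (M m) {\<omega> \<in> space (M m). T m \<omega> > t}
      \<le> measure (M m) {\<omega> \<in> space (M m). T m \<omega> \<ge> t}" if "m \<ge> 2" for m t
    using prob_space.finite_measure[OF prob[OF that]] T_set[OF that, of "{t..}"]
    by (intro finite_measure.finite_measure_mono) auto
  have T_ge_le_T_gt: "measure (M m) {\<omega> \<in> space (M m). T m \<omega> \<ge> s}
      \<le> measure (M m) {\<omega> \<in> space (M m). T m \<omega> > t}" if "m \<ge> 2" "t < s" for m s t
    using prob_space.finite_measure[OF prob[OF that(1)]] T_set[OF that(1), of "{t<..}"] that
    by (intro finite_measure.finite_measure_mono) auto
  have T_ge_lim: "(\<lambda>m. measure (M m) {\<omega> \<in> space (M m). T m \<omega> \<ge> t}) \<longlonglongrightarrow> ?h t"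
    if t: "t \<in> {0..<1}" for t
  proof (rule tendsto_squeeze_at_right[where b = 1 and q = ?q and h = ?h])
    show "\<forall>\<^sub>F m in sequentially. measure (M m) {\<omega> \<in> space (M m). T m \<omega> \<ge> t} \<le> ?q t m"
      using eventually_ge_at_top[of "2::nat"]
      by eventually_elim (auto simp: T_ge intro!: q_anti nat_mono floor_le_ceiling)
    fix s assume s: "t < s" "s < 1"
    show "\<forall>\<^sub>F m in sequentially. ?q s m \<le> measure (M m) {\<omega> \<in> space (M m). T m \<omega> \<ge> t}"
      using eventually_ge_at_top[of "2::nat"] eventually_ceiling_le_floor[OF s(1)]
      by eventually_elim (auto simp: T_ge intro!: q_anti nat_mono)
  qed (use t in \<open>auto intro!: q_lim tendsto_inverse_sqrt_at_right\<close>)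
  have T_gt_lim: "(\<lambda>m. measure (M m) {\<omega> \<in> space (M m). T m \<omega> > t}) \<longlonglongrightarrow> ?h t"
    if t: "t \<in> {0..<1}" for t
  \<comment> \<open>The closed tails, whose limits are now known, serve as the bounds
    \<open>q\<close>.\<close>
  proof (rule tendsto_squeeze_at_right[where b = 1 and h = ?h
        and q = "\<lambda>t m. measure (M m) {\<omega> \<in> space (M m). T m \<omega> \<ge> t}"])
    show "\<forall>\<^sub>F m in sequentially. measure (M m) {\<omega> \<in> space (M m). T m \<omega> > t}
        \<le> measure (M m) {\<omega> \<in> space (M m). T m \<omega> \<ge> t}"
      using eventually_ge_at_top[of "2::nat"] by eventually_elim (rule T_gt_le_T_ge)
    fix s assume s: "t < s" "s < 1"
    show "\<forall>\<^sub>F m in sequentially. measure (M m) {\<omega> \<in> space (M m). T m \<omega> \<ge> s}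
        \<le> measure (M m) {\<omega> \<in> space (M m). T m \<omega> > t}"
      using eventually_ge_at_top[of "2::nat"] by eventually_elim (rule T_ge_le_T_gt[OF _ s(1)])
  qed (use t in \<open>auto intro!: T_ge_lim tendsto_inverse_sqrt_at_right\<close>)
  have distr_real: "real_distribution (distr (M m) borel (T m))" if "m \<ge> 2" for m
    using that prob_space.real_distribution_distr[OF prob T_rv] by blast
  have weak: "weak_conv_m (\<lambda>m. distr (M m) borel (T m)) mu_limit"
  proof (rule weak_conv_m_mu_limit[OF distr_real])
    fix m :: nat assume m: "m \<ge> 2"
    interpret prob_space "M m" by (rule prob[OF m])
    have "T m \<omega> \<in> {0..1}" if "\<omega> \<in> space (M m)" for \<omega>
      using measurable_space[OF K_rv[OF m] that] m by (auto simp: T field_simps)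
    then have "T m -` {0..1} \<inter> space (M m) = space (M m)" by auto
    then show "measure (distr (M m) borel (T m)) {0..1} = 1"
      using T_rv[OF m] by (simp add: measure_distr prob_space)
  next
    fix t :: real assume t: "t \<in> {0..<1}"
    have "\<forall>\<^sub>F m in sequentially. measure (M m) {\<omega> \<in> space (M m). T m \<omega> > t}
        = measure (distr (M m) borel (T m)) {t<..}"
      using eventually_ge_at_top[of "2::nat"]
      by eventually_elim (simp add: measure_distr T_rv vimage_def Int_def conj_commute)
    then show "(\<lambda>m. measure (distr (M m) borel (T m)) {t<..}) \<longlonglongrightarrow> ?h t"
      by (rule Lim_transform_eventually[OF T_gt_lim[OF t]])
  qed
  have conv_weak: "conv_weakly (\<lambda>m. mu_fin (v m) m) mu_limit"
  proof (rule conv_weakly_of_weak_conv_m[OF _ real_distribution_mu_limit])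
    \<comment> \<open>The two measures are identified only for \<open>m \<ge> 2\<close>, so limits
      pass along an eventual equality.\<close>
    have "\<forall>\<^sub>F m in sequentially. cdf (distr (M m) borel (T m)) x = cdf (mu_fin (v m) m) x" for x
      using eventually_ge_at_top[of "2::nat"] by eventually_elim (simp add: distr_T)
    then show "weak_conv_m (\<lambda>m. mu_fin (v m) m) mu_limit"
      using weak unfolding weak_conv_m_def weak_conv_def by (blast intro: Lim_transform_eventually)
    show "real_distribution (mu_fin (v m) m)" if "m \<ge> 2" for m
      using distr_real[OF that] distr_T[OF that] by simp
  qed
  have conv_dist: "conv_in_distribution M T N X"
    if "distr N borel X = mu_limit" for N :: "'c measure" and X
    using weak that by (simp add: conv_in_distribution_def)
  have char: "distr N borel X = mu_limit \<longleftrightarrow>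
      (\<forall>t\<in>{0..<1}. measure N {\<omega> \<in> space N. X \<omega> \<ge> t} = ?h t)
      \<and> measure N {\<omega> \<in> space N. X \<omega> = 1} = 1 / sqrt 3"
    if N: "prob_space N" "X \<in> borel_measurable N" for N :: "'b measure" and X
  proof -
    \<comment> \<open>Rewrites the events on \<open>N\<close> as events of the law of
      \<open>X\<close>, to which \<open>eq_mu_limit_iff\<close> applies.\<close>
    have "measure (distr N borel X) A = measure N {\<omega> \<in> space N. X \<omega> \<in> A}" if "A \<in> sets borel" for A
      using N that by (simp add: measure_distr vimage_def Int_def conj_commute)
    then show ?thesis
      using eq_mu_limit_iff[OF prob_space.real_distribution_distr[OF N]] by simp
  qed
  \<comment> \<open>The witness is \<open>mu_limit\<close> with the identity map. Existence is
    claimed separately because a given type \<open>'b\<close> may carry no variable with this law,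
    which would make the universal claim over \<open>'b\<close> say little.\<close>
  have exists: "\<exists>(N :: real measure) X. prob_space N \<and> X \<in> borel_measurable N
      \<and> distr N borel X = mu_limit \<and> conv_in_distribution M T N X"
  proof (intro exI conjI)
    show "prob_space mu_limit"
      using real_distribution_mu_limit by (simp add: real_distribution_def)
    show "(\<lambda>x. x) \<in> borel_measurable mu_limit"
      by (simp add: measurable_ident_sets sets_mu_limit)
    show "distr mu_limit borel (\<lambda>x. x) = mu_limit"
      by (simp add: distr_id2 sets_mu_limit)
    then show "conv_in_distribution M T mu_limit (\<lambda>x. x)"
      using weak by (simp add: conv_in_distribution_def)
  qed
  have law: "\<forall>(N :: 'b measure) X. prob_space N \<and> X \<in> borel_measurable N \<longrightarrow>
      (distr N borel X = mu_limit \<longrightarrow> conv_in_distribution M T N X)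
    \<and> (distr N borel X = mu_limit \<longleftrightarrow>
        (\<forall>t\<in>{0..<1}. measure N {\<omega> \<in> space N. X \<omega> \<ge> t} = ?h t)
        \<and> measure N {\<omega> \<in> space N. X \<omega> = 1} = 1 / sqrt 3)"
    by (intro allI conjI impI conv_dist char; (elim conjE)?; assumption)
  show ?thesis
    using distr_T T_ge[unfolded q_tail_def] T_ge_lim T_one
    by (intro conjI allI ballI impI exists conv_weak law) (simp_all add: q_tail_def)
qed

end
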